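(* The curve $\{(x,y)\in\mathbb{R}^2:|x|^{2.001}+|y|^{2.001}=1\}$ has five-point subsets whose conic is a hyperbola; that is, there exist five distinct points of this curve such that the unique conic passing through them is a hyperbola. Thus it is false that every five-point subset of this curve determines an ellipse.
   Context: A conic in the real plane with affine coordinates $(x,y)$ is given by an equation $F+Ey+Cy^2+Dx+Bxy+Ax^2=0$ with real coefficients not all zero, two equations being identified if they are proportional; "unique" means unique up to a nonzero scalar multiple of the equation. The conic is nondegenerate if the associated symmetric $3\times3$ matrix of its homogenization is nonsingular. With discriminant $\Delta=B^2-4AC$, a hyperbola is a nondegenerate conic with $\Delta>0$, and an ellipse is a nondegenerate conic with $\Delta<0$ (and nonempty real locus). A five-point set determines an ellipse (respectively hyperbola) if the unique conic through its five points is an ellipse (respectively hyperbola). *)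

theory Defs
  imports "HOL-Analysis.Analysis"
begin

text \<open>
  The coefficients of \<open>F + E y + C y\<^sup>2 + D x + B x y + A x\<^sup>2 = 0\<close>. A conic is such an equation
  with coefficients not all zero; proportional equations represent the same conic.
\<close>

record conic_eq =
  coF :: real
  coE :: real
  coC :: real
  coD :: real
  coB :: real
  coA :: real

definition is_conic :: "conic_eq \<Rightarrow> bool" where
  "is_conic q \<longleftrightarrow>
     \<not> (coF q = 0 \<and> coE q = 0 \<and> coC q = 0 \<and> coD q = 0 \<and> coB q = 0 \<and> coA q = 0)"

definition conic_scale :: "real \<Rightarrow> conic_eq \<Rightarrow> conic_eq" where
  "conic_scale c q =
     \<lparr>coF = c * coF q, coE = c * coE q, coC = c * coC q,
      coD = c * coD q, coB = c * coB q, coA = c * coA q\<rparr>"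

definition proportional :: "conic_eq \<Rightarrow> conic_eq \<Rightarrow> bool" where
  "proportional q r \<longleftrightarrow> (\<exists>c. c \<noteq> 0 \<and> r = conic_scale c q)"

definition conic_locus :: "conic_eq \<Rightarrow> (real \<times> real) set" where
  "conic_locus q =
     {(x, y). coF q + coE q * y + coC q * y\<^sup>2 + coD q * x + coB q * x * y + coA q * x\<^sup>2 = 0}"

definition conic_matrix :: "conic_eq \<Rightarrow> real^3^3" where
  "conic_matrix q =
     vector [vector [coA q, coB q / 2, coD q / 2],
             vector [coB q / 2, coC q, coE q / 2],
             vector [coD q / 2, coE q / 2, coF q]]"

lemma conic_matrix_homogenization:
  fixes x y z :: real
  defines "v \<equiv> vector [x, y, z] :: real^3"
  shows "v \<bullet> (conic_matrix q *v v) =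
    coF q * z\<^sup>2 + coE q * y * z + coC q * y\<^sup>2 + coD q * x * z + coB q * x * y + coA q * x\<^sup>2"
  unfolding v_def
  by (simp add: conic_matrix_def inner_vec_def matrix_vector_mult_def sum_3
      power2_eq_square algebra_simps)

definition nondegenerate :: "conic_eq \<Rightarrow> bool" where
  "nondegenerate q \<longleftrightarrow> invertible (conic_matrix q)"

definition discriminant :: "conic_eq \<Rightarrow> real" where
  "discriminant q = (coB q)\<^sup>2 - 4 * coA q * coC q"

definition hyperbola :: "conic_eq \<Rightarrow> bool" where
  "hyperbola q \<longleftrightarrow> is_conic q \<and> nondegenerate q \<and> discriminant q > 0"

definition ellipse :: "conic_eq \<Rightarrow> bool" where
  "ellipse q \<longleftrightarrow>
     is_conic q \<and> nondegenerate q \<and> discriminant q < 0 \<and> conic_locus q \<noteq> {}"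

definition conic_through :: "(real \<times> real) set \<Rightarrow> conic_eq \<Rightarrow> bool" where
  "conic_through P q \<longleftrightarrow> is_conic q \<and> P \<subseteq> conic_locus q"

definition unique_conic_through :: "(real \<times> real) set \<Rightarrow> conic_eq \<Rightarrow> bool" where
  "unique_conic_through P q \<longleftrightarrow>
     conic_through P q \<and> (\<forall>r. conic_through P r \<longrightarrow> proportional q r)"

definition determines_ellipse :: "(real \<times> real) set \<Rightarrow> bool" where
  "determines_ellipse P \<longleftrightarrow> (\<exists>q. unique_conic_through P q \<and> ellipse q)"

definition determines_hyperbola :: "(real \<times> real) set \<Rightarrow> bool" where
  "determines_hyperbola P \<longleftrightarrow> (\<exists>q. unique_conic_through P q \<and> hyperbola q)"

end

theory Submission
  imports Defs
begin

text \<open>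
  Near its apex \<open>(0, 1)\<close> the curve looks like \<open>1 - y = \<bar>x\<bar>\<^sup>p / p\<close> with \<open>p = 2.001\<close>, which for
  \<open>p > 2\<close> is steeper than a parabola at large scales and flatter at small ones. Take the points
  \<open>(0, 1)\<close>, \<open>(\<plusminus>a, 1 - u)\<close>, \<open>(b, 1 - w)\<close>, \<open>(1, 0)\<close> on the curve with \<open>a\<close> far smaller than \<open>b\<close> and
  \<open>b\<close> far smaller than \<open>1\<close>. In the coordinate \<open>v = 1 - y\<close>, the conics through the first three are
  \<open>A (x\<^sup>2 - (a\<^sup>2/u) v) + B x (v - u) + C v (v - u) = 0\<close>. Dividing by \<open>x (v - u)\<close>, the last two
  points give the equations \<open>A f\<^sub>i + B + C g\<^sub>i = 0\<close>, where \<open>f\<^sub>1 < f\<^sub>2\<close> and \<open>g\<^sub>1 < g\<^sub>2\<close>. Hence \<open>A\<close> and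
  \<open>C\<close> have opposite signs, and the discriminant is positive.
\<close>

section \<open>Invariants of a conic: determinant and discriminant\<close>

text \<open>The expression is four times the determinant of \<open>conic_matrix q\<close>; the
  factor 4 clears the halves.\<close>

lemma nondegenerate_iff:
  "nondegenerate q \<longleftrightarrow>
     coA q * (4 * coC q * coF q - (coE q)\<^sup>2) - coB q * (coB q * coF q - coE q * coD q)
       - coC q * (coD q)\<^sup>2 \<noteq> 0"
proof -
  have "4 * det (conic_matrix q) =
     coA q * (4 * coC q * coF q - (coE q)\<^sup>2) - coB q * (coB q * coF q - coE q * coD q)
       - coC q * (coD q)\<^sup>2"
    by (simp add: conic_matrix_def det_3 power2_eq_square algebra_simps)
  then show ?thesis
    unfolding nondegenerate_def invertible_det_nz by auto
qed

text \<open>The discriminant is quadratic in the coefficients, so scaling by \<open>c\<close>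
  multiplies it by \<open>c\<^sup>2\<close>.\<close>

lemma discriminant_proportional:
  assumes "proportional q r"
  shows "discriminant r > 0 \<longleftrightarrow> discriminant q > 0"
proof -
  obtain c where c: "c \<noteq> 0" "r = conic_scale c q"
    using assms by (auto simp: proportional_def)
  then have "discriminant r = c\<^sup>2 * discriminant q"
    by (simp add: discriminant_def conic_scale_def power2_eq_square algebra_simps)
  with c show ?thesis
    by (simp add: zero_less_mult_iff)
qed

lemma determines_hyperbola_not_ellipse:
  assumes "determines_hyperbola P"
  shows "\<not> determines_ellipse P"
proof
  assume "determines_ellipse P"
  then obtain r where r: "unique_conic_through P r" "discriminant r < 0"
    by (auto simp: determines_ellipse_def ellipse_def)
  obtain q where q: "unique_conic_through P q" "discriminant q > 0"
    using assms by (auto simp: determines_hyperbola_def hyperbola_def)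
  have "proportional q r"
    using q(1) r(1) by (auto simp: unique_conic_through_def)
  then show False
    using discriminant_proportional q(2) r(2) by fastforce
qed

section \<open>Linear algebra of conics through the five points\<close>

definition five_points :: "real \<Rightarrow> real \<Rightarrow> real \<Rightarrow> real \<Rightarrow> (real \<times> real) set" where
  "five_points a u b w = {(0, 1), (a, 1 - u), (- a, 1 - u), (b, 1 - w), (1, 0)}"

lemma card_five_points:
  assumes "a \<noteq> 0" "0 < u" "u < w" "w < 1"
  shows "card (five_points a u b w) = 5"
  using assms by (simp add: five_points_def)

text \<open>The difference and sum of the conditions at the two symmetric points give
  \<open>coD\<close> and \<open>coE\<close>, the apex gives \<open>coF\<close>, and the last two
  points each give \<open>coB\<close>. All is then expressed by \<open>coA\<close> and
  \<open>coC\<close>, which satisfy one linear relation.\<close>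

lemma five_points_subset_conic_locus_iff:
  assumes "a \<noteq> 0" "0 < u" "u < w" "w < 1" "b \<noteq> 0"
  shows "five_points a u b w \<subseteq> conic_locus q \<longleftrightarrow>
    coD q = - coB q * (1 - u) \<and>
    coE q = coA q * (a\<^sup>2 / u) + coC q * (u - 2) \<and>
    coF q = - coE q - coC q \<and>
    coB q = coA q * ((b\<^sup>2 - a\<^sup>2 / u * w) / (b * (w - u))) + coC q * (w / b) \<and>
    coB q = coA q * ((1 - a\<^sup>2 / u) / (1 - u)) + coC q"
proof -
  obtain F E C D B A where q: "q = \<lparr>coF = F, coE = E, coC = C, coD = D, coB = B, coA = A\<rparr>"
    by (cases q)
  define r where "r = a\<^sup>2 / u"
  have a2: "a\<^sup>2 = r * u"
    using assms by (simp add: r_def)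
  have "five_points a u b w \<subseteq> conic_locus q \<longleftrightarrow>
    F + E + C = 0 \<and>
    F + E * (1 - u) + C * (1 - u)\<^sup>2 + D * a + B * a * (1 - u) + A * a\<^sup>2 = 0 \<and>
    F + E * (1 - u) + C * (1 - u)\<^sup>2 - D * a - B * a * (1 - u) + A * a\<^sup>2 = 0 \<and>
    F + E * (1 - w) + C * (1 - w)\<^sup>2 + D * b + B * b * (1 - w) + A * b\<^sup>2 = 0 \<and>
    F + D + A = 0"
    by (simp add: five_points_def conic_locus_def q)
  also have "\<dots> \<longleftrightarrow>
    F + E + C = 0 \<and>
    a * (D + B * (1 - u)) = 0 \<and>
    F + E * (1 - u) + C * (1 - u)\<^sup>2 + A * a\<^sup>2 = 0 \<and>
    F + E * (1 - w) + C * (1 - w)\<^sup>2 + D * b + B * b * (1 - w) + A * b\<^sup>2 = 0 \<and>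
    F + D + A = 0"
    by (auto simp: algebra_simps)
  also have "\<dots> \<longleftrightarrow>
    F = - E - C \<and>
    D = - B * (1 - u) \<and>
    F + E * (1 - u) + C * (1 - u)\<^sup>2 + A * a\<^sup>2 = 0 \<and>
    F + E * (1 - w) + C * (1 - w)\<^sup>2 + D * b + B * b * (1 - w) + A * b\<^sup>2 = 0 \<and>
    F + D + A = 0"
    unfolding mult_eq_0_iff using assms by (intro conj_cong) auto
  also have "\<dots> \<longleftrightarrow>
    F = - E - C \<and>
    D = - B * (1 - u) \<and>
    u * (A * r + C * (u - 2) - E) = 0 \<and>
    - E * w + C * (w\<^sup>2 - 2 * w) + B * b * (u - w) + A * b\<^sup>2 = 0 \<and>
    - E - C - B * (1 - u) + A = 0"
    by (intro conj_cong refl; simp only: a2; simp add: algebra_simps power2_eq_square)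
  also have "\<dots> \<longleftrightarrow>
    F = - E - C \<and>
    D = - B * (1 - u) \<and>
    E = A * r + C * (u - 2) \<and>
    - E * w + C * (w\<^sup>2 - 2 * w) + B * b * (u - w) + A * b\<^sup>2 = 0 \<and>
    - E - C - B * (1 - u) + A = 0"
    unfolding mult_eq_0_iff using assms by (intro conj_cong) auto
  also have "\<dots> \<longleftrightarrow>
    F = - E - C \<and>
    D = - B * (1 - u) \<and>
    E = A * r + C * (u - 2) \<and>
    B * (b * (w - u)) = A * (b\<^sup>2 - r * w) + C * w * (w - u) \<and>
    B * (1 - u) = A * (1 - r) + C * (1 - u)"
    by (intro conj_cong refl; simp only:; auto simp: algebra_simps power2_eq_square)
  also have "B * (b * (w - u)) = A * (b\<^sup>2 - r * w) + C * w * (w - u) \<longleftrightarrow>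
      B = A * ((b\<^sup>2 - r * w) / (b * (w - u))) + C * (w / b)"
  proof -
    have nz: "b * (w - u) \<noteq> 0"
      using assms by simp
    then have "(A * ((b\<^sup>2 - r * w) / (b * (w - u))) + C * (w / b)) * (b * (w - u))
        = A * (b\<^sup>2 - r * w) + C * w * (w - u)"
      by (simp add: distrib_right)
    with mult_right_cancel[OF nz] show ?thesis
      by metis
  qed
  also have "B * (1 - u) = A * (1 - r) + C * (1 - u) \<longleftrightarrow> B = A * ((1 - r) / (1 - u)) + C"
    using assms by (simp add: field_simps)
  finally show ?thesis
    unfolding r_def q by auto
qed

text \<open>
  Up to a positive factor, the determinant of the conic is
  \<open>B\<^sup>2 a\<^sup>2 - (a\<^sup>2/u \<cdot> A + C u)\<^sup>2\<close>; the last assumption keeps it negative.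
\<close>
lemma five_points_determine_hyperbola:
  fixes a b u w :: real
  defines "f1 \<equiv> (b\<^sup>2 - a\<^sup>2 / u * w) / (b * (w - u))"
    and "f2 \<equiv> (1 - a\<^sup>2 / u) / (1 - u)"
  assumes pos: "a \<noteq> 0" "0 < u" "u < w" "w < 1" "0 < b" "w < b"
    and less: "f1 < f2"
    and nondeg: "\<bar>(w / b * f2 - f1) * a\<bar> < a\<^sup>2 / u * (1 - w / b) + (f1 - f2) * u"
  shows "determines_hyperbola (five_points a u b w)"
proof -
  define g where "g = w / b"
  define r where "r = a\<^sup>2 / u"
  \<comment> \<open>Equating the two expressions for \<open>coB\<close> gives
    \<open>coA * (f1 - f2) = coC * (1 - g)\<close>, which these \<open>A\<close> and
    \<open>C\<close> solve; the common value is then \<open>- B\<close>.\<close>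
  define A B C where ABC: "A = 1 - g" "B = g * f2 - f1" "C = f1 - f2"
  define E where "E = A * r + C * (u - 2)"
  define q where "q = \<lparr>coF = - E - C, coE = E, coC = C,
      coD = B * (1 - u), coB = - B, coA = A\<rparr>"
  have g: "g < 1"
    using pos by (simp add: g_def)
  have iff: "five_points a u b w \<subseteq> conic_locus s \<longleftrightarrow>
    coD s = - coB s * (1 - u) \<and> coE s = coA s * r + coC s * (u - 2) \<and>
    coF s = - coE s - coC s \<and>
    coB s = coA s * f1 + coC s * g \<and> coB s = coA s * f2 + coC s" for s
    unfolding f1_def f2_def g_def r_def
    using pos by (intro five_points_subset_conic_locus_iff) auto
  have A: "A > 0" and C: "C < 0"
    using g less by (simp_all add: ABC)
  then have conic: "is_conic q"
    by (simp add: is_conic_def q_def)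
  have "five_points a u b w \<subseteq> conic_locus q"
    unfolding iff q_def by (simp add: E_def ABC algebra_simps)
  with conic have through: "conic_through (five_points a u b w) q"
    by (simp add: conic_through_def)
  have "proportional q s" if s: "conic_through (five_points a u b w) s" for s
  proof -
    define k where "k = coA s / A"
    have kA: "coA s = k * A"
      using A by (simp add: k_def)
    have eqs: "coD s = - coB s * (1 - u)" "coE s = coA s * r + coC s * (u - 2)"
      "coF s = - coE s - coC s" "coB s = coA s * f1 + coC s * g" "coB s = coA s * f2 + coC s"
      using s unfolding conic_through_def iff by blast+
    have "A * coC s = A * (k * C)"
      using eqs(4,5) by (simp add: kA ABC algebra_simps)
    then have kC: "coC s = k * C"
      using A by simp
    have kB: "coB s = - (k * B)"
      unfolding eqs(5) kA kC by (simp add: ABC algebra_simps)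
    have "s = conic_scale k q"
      by (rule conic_eq.equality)
         (simp_all add: conic_scale_def q_def eqs(1-3) kA kB kC E_def algebra_simps)
    moreover from this have "k \<noteq> 0"
      using s by (cases "k = 0") (simp_all add: conic_through_def is_conic_def conic_scale_def)
    ultimately show ?thesis
      by (auto simp: proportional_def)
  qed
  with through have uniq: "unique_conic_through (five_points a u b w) q"
    by (simp add: unique_conic_through_def)
  have "4 * A * C < 0"
    using A C by (simp add: mult_pos_neg)
  then have "discriminant q > 0"
    by (simp add: discriminant_def q_def order_less_le_trans[OF _ zero_le_power2])
  moreover have "nondegenerate q"
  proof -
    have "\<bar>B * a\<bar> < r * A + C * u"
      using nondeg by (simp add: ABC g_def r_def)
    then have "(B * a)\<^sup>2 < (r * A + C * u)\<^sup>2"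
      by (simp add: power2_strict_mono)
    moreover have "a\<^sup>2 = r * u"
      using pos by (simp add: r_def)
    ultimately have "B\<^sup>2 * (r * u) - (r * A + C * u)\<^sup>2 \<noteq> 0"
      by (simp add: power_mult_distrib)
    moreover have "A * (4 * C * (- E - C) - E\<^sup>2) - - B * (- B * (- E - C) - E * (B * (1 - u)))
       - C * (B * (1 - u))\<^sup>2 = A * (B\<^sup>2 * (r * u) - (r * A + C * u)\<^sup>2)"
      by (simp add: E_def power2_eq_square algebra_simps)
    ultimately show ?thesis
      unfolding nondegenerate_iff q_def using A by simp
  qed
  ultimately show ?thesis
    using conic uniq by (auto simp: determines_hyperbola_def hyperbola_def)
qed


section \<open>Estimates for the depth below the apex\<close>

text \<open>The depth \<open>1 - y\<close> below the apex of the point of the curve with \<open>\<bar>x\<bar>\<^sup>p = t\<close> and \<open>y \<ge> 0\<close>.\<close>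
definition cap :: "real \<Rightarrow> real \<Rightarrow> real" where
  "cap p t = 1 - (1 - t) powr (1 / p)"

lemma cap_powr:
  assumes "p > 0" "t \<le> 1"
  shows "(1 - cap p t) powr p = 1 - t"
  using assms by (simp add: cap_def powr_powr)

lemma cap_less_1:
  assumes "t < 1"
  shows "cap p t < 1"
  using assms by (simp add: cap_def)

lemma cap_nonneg:
  assumes "p > 0" "0 \<le> t" "t \<le> 1"
  shows "0 \<le> cap p t"
  using assms powr_mono2[of "1 / p" "1 - t" 1] by (simp add: cap_def)

lemma cap_le:
  assumes "p \<ge> 1" "0 \<le> t" "t \<le> 1"
  shows "cap p t \<le> t"
  using assms powr_mono'[of "1 / p" 1 "1 - t"] by (simp add: cap_def)

text \<open>Rounding the exponent up to a natural number \<open>n\<close> makes Bernoulli's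
  inequality applicable.\<close>

lemma cap_ge:
  assumes "0 < p" "p \<le> real n" "0 \<le> t" "t < 1"
  shows "t \<le> real n * cap p t"
proof -
  have u: "0 \<le> cap p t" "cap p t < 1"
    using assms cap_nonneg cap_less_1 by auto
  have "1 - real n * cap p t \<le> (1 - cap p t) ^ n"
    using Bernoulli_inequality[of "- cap p t" n] u by simp
  also have "\<dots> = (1 - cap p t) powr real n"
    using u by (simp add: powr_realpow)
  also have "\<dots> \<le> (1 - cap p t) powr p"
    using assms u by (intro powr_mono') auto
  also have "\<dots> = 1 - t"
    using assms by (intro cap_powr) auto
  finally show ?thesis
    by simp
qed

text \<open>By convexity of the \<open>p\<close>-th power, the chord from 1 to
  \<open>1 - cap p t\<close> bounds its values.\<close>

lemma cap_mult_le:
  assumes "p \<ge> 1" "0 \<le> \<theta>" "\<theta> \<le> 1" "0 \<le> t" "t < 1"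
  shows "cap p (\<theta> * t) \<le> \<theta> * cap p t"
proof -
  have t: "\<theta> * t \<le> 1"
    using assms by (simp add: mult_le_one)
  define y where "y = 1 - cap p t"
  have y: "y > 0"
    using assms cap_less_1 by (simp add: y_def)
  have "((1 - \<theta>) * 1 + \<theta> * y) powr p \<le> (1 - \<theta>) * 1 powr p + \<theta> * y powr p"
    using convex_onD[OF powr_convex[OF assms(1)], of \<theta> 1 y] assms y by simp
  also have "\<dots> = 1 - \<theta> * t"
    using assms by (simp add: y_def cap_powr algebra_simps)
  finally have "(((1 - \<theta>) * 1 + \<theta> * y) powr p) powr (1 / p) \<le> (1 - \<theta> * t) powr (1 / p)"
    using assms by (intro powr_mono2) auto
  moreover have "(1 - \<theta>) * 1 + \<theta> * y \<ge> 0"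
    using assms y by simp
  ultimately have "(1 - \<theta>) + \<theta> * y \<le> (1 - \<theta> * t) powr (1 / p)"
    using assms by (simp add: powr_powr)
  then show ?thesis
    by (simp add: cap_def[of p "\<theta> * t"] y_def algebra_simps)
qed

section \<open>The explicit five points\<close>

text \<open>Take \<open>a = s\<^sup>2\<close> and \<open>b = s\<close>. On a parabola the depths
  would have ratio \<open>s\<^sup>2\<close>; here \<open>u / w\<close> is at most half of that. This
  makes \<open>f1\<close> negative of order \<open>1 / s\<close>, while \<open>f2\<close> stays
  bounded.\<close>

lemma hyperbola_on_superellipse:
  fixes S :: "(real \<times> real) set"
  defines "S \<equiv> {(x, y). \<bar>x\<bar> powr 2.001 + \<bar>y\<bar> powr 2.001 = 1}"
  obtains P where "P \<subseteq> S" "card P = 5" "determines_hyperbola P"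
proof -
  define p :: real where "p = 2.001"
  \<comment> \<open>As \<open>1000 p = 2001\<close>, this choice makes \<open>s\<^sup>p = s\<^sup>2 / 2\<close> exact.\<close>
  define s :: real where "s = 2 powr - 1000"
  have "2 powr - 1000 \<le> (2::real) powr - 10"
    by (intro powr_mono) auto
  then have s: "0 < s" "s \<le> 1 / 1000"
    by (simp_all add: s_def powr_minus)
  have sp: "s powr p = s\<^sup>2 / 2"
  proof -
    have "s powr p = 2 powr (- 2000 + - 1)"
      by (simp add: s_def p_def powr_powr)
    also have "\<dots> = 2 powr - 2000 / 2"
      unfolding powr_add by (simp add: powr_minus)
    also have "2 powr - 2000 = s\<^sup>2"
      by (simp add: s_def power2_eq_square flip: powr_add)
    finally show ?thesis .
  qed
  have s2p: "(s\<^sup>2) powr p = s ^ 4 / 4"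
  proof -
    have "(s\<^sup>2) powr p = (s powr p)\<^sup>2"
      using s by (simp add: power2_eq_square powr_mult)
    then show ?thesis
      by (simp add: sp power_divide)
  qed
  define u w where "u = cap p (s ^ 4 / 4)" and "w = cap p (s\<^sup>2 / 2)"
  define r f1 f2 g where "r = s ^ 4 / u" and "f1 = (s\<^sup>2 - r * w) / (s * (w - u))"
    and "f2 = (1 - r) / (1 - u)" and "g = w / s"
  have s2: "s\<^sup>2 \<le> s / 1000"
    using s by (simp add: power2_eq_square)
  have s4: "s ^ 4 \<le> s\<^sup>2 / 1000000"
  proof -
    have "s\<^sup>2 * s\<^sup>2 \<le> s\<^sup>2 * (1 / 1000)\<^sup>2"
      using s by (intro mult_left_mono power_mono) auto
    then show ?thesis
      by (simp add: power2_eq_square power4_eq_xxxx mult.assoc)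
  qed
  have pos: "0 < s\<^sup>2" "0 < s ^ 4"
    using s by simp_all
  have u_le: "u \<le> s ^ 4 / 4" and w_le: "w \<le> s\<^sup>2 / 2"
    unfolding u_def w_def using s s2 s4 pos by (intro cap_le; simp add: p_def)+
  have u_ge: "s ^ 4 / 4 \<le> 3 * u" and w_ge: "s\<^sup>2 / 2 \<le> 3 * w"
    unfolding u_def w_def
    using cap_ge[of p 3 "s ^ 4 / 4"] cap_ge[of p 3 "s\<^sup>2 / 2"] s s2 s4 pos
    by (simp_all add: p_def)
  \<comment> \<open>Convexity with both the factor and the argument equal to
    \<open>s\<^sup>2 / 2\<close>.\<close>
  have uw: "u \<le> s\<^sup>2 / 2 * w"
  proof -
    have "s\<^sup>2 / 2 * (s\<^sup>2 / 2) = s ^ 4 / 4"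
      by (simp add: power2_eq_square power4_eq_xxxx)
    with cap_mult_le[of p "s\<^sup>2 / 2" "s\<^sup>2 / 2"] s s2 pos show ?thesis
      by (simp add: u_def w_def p_def)
  qed
  have u: "0 < u" and w: "0 < w"
    using u_ge w_ge pos by linarith+
  have u2: "u \<le> w / 2"
  proof -
    have "s\<^sup>2 / 2 * w \<le> 1 / 2 * w"
      using w s s2 by (intro mult_right_mono) auto
    with uw show ?thesis by simp
  qed
  have r_ge: "4 \<le> r" and r_le: "r \<le> 12"
    using u u_le u_ge by (simp_all add: r_def field_simps)
  \<comment> \<open>The parabola \<open>x\<^sup>2 = r * v\<close> through the apex and the symmetric
    points has \<open>x\<^sup>2 \<ge> 2 * s\<^sup>2\<close> at depth \<open>w\<close>, so the fourth
    point lies well inside it.\<close>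
  have rw_ge: "2 * s\<^sup>2 \<le> r * w"
  proof -
    have "2 * s\<^sup>2 * u \<le> 2 * s\<^sup>2 * (s\<^sup>2 / 2 * w)"
      using uw pos by (intro mult_left_mono) auto
    also have "\<dots> = s ^ 4 * w"
      by (simp add: power2_eq_square power4_eq_xxxx)
    finally show ?thesis
      using u by (simp add: r_def field_simps)
  qed
  have f1_le: "f1 \<le> - 2 / s"
  proof -
    have "2 * (w - u) \<le> s\<^sup>2"
      using w_le u by simp
    then have "s\<^sup>2 - r * w \<le> - 2 * (w - u)"
      using rw_ge by simp
    then show ?thesis
      using s u2 w by (simp add: f1_def divide_simps)
  qed
  have f1_ge: "- 24 / s \<le> f1"
  proof -
    have "r * w \<le> 12 * w"
      using r_le w by simp
    also have "\<dots> \<le> 24 * (w - u)"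
      using u2 by simp
    finally have "s\<^sup>2 - r * w \<ge> - 24 * (w - u)"
      using pos by linarith
    then show ?thesis
      using s u2 w by (simp add: f1_def divide_simps)
  qed
  have u_small: "u \<le> 1 / 2"
    using u_le s4 s2 s by simp
  have f2_le: "f2 \<le> 0"
    using r_ge u_small by (simp add: f2_def divide_simps)
  have f2_ge: "- 22 \<le> f2"
    using r_le u_small by (simp add: f2_def divide_simps)
  have g: "0 \<le> g" "g \<le> s / 2"
    using w w_le s by (simp_all add: g_def field_simps power2_eq_square)
  have inv_s: "1000 \<le> 1 / s"
    using s by (simp add: field_simps)
  have less: "f1 < f2"
    using f1_le f2_ge inv_s by simp
  have gf2: "- 22 * g \<le> g * f2" "g * f2 \<le> 0"
    using g f2_le f2_ge mult_left_mono[of "- 22" f2 g] by (simp_all add: mult_nonneg_nonpos)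
  \<comment> \<open>For nondegeneracy, the left side is at most \<open>24 * s\<close> and the right
    side at least \<open>2 - 24 * s\<close>; \<open>s \<le> 1 / 1000\<close> separates them.\<close>
  have lower: "0 \<le> (g * f2 - f1) * s\<^sup>2"
    using gf2 f1_le inv_s g s by (intro mult_nonneg_nonneg) auto
  have "(g * f2 - f1) * s\<^sup>2 \<le> 24 / s * s\<^sup>2"
    using gf2 f1_ge by (intro mult_right_mono) auto
  also have "\<dots> = 24 * s"
    using s by (simp add: power2_eq_square)
  finally have upper: "(g * f2 - f1) * s\<^sup>2 \<le> 24 * s" .
  have "24 / s * u \<le> 24 / s * s\<^sup>2"
    using u_le s4 pos(1) s by (intro mult_left_mono) (linarith, simp)
  also have "\<dots> = 24 * s"
    using s by (simp add: power2_eq_square)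
  finally have "24 / s * u \<le> 24 * s" .
  moreover have "(- 24 / s) * u \<le> (f1 - f2) * u"
    using f1_ge f2_le u by (intro mult_right_mono) auto
  ultimately have E1: "- (24 * s) \<le> (f1 - f2) * u"
    by simp
  have "4 * (1 / 2) \<le> r * (1 - g)"
    using r_ge g s by (intro mult_mono) auto
  then have E2: "2 \<le> r * (1 - g)"
    by simp
  have a4: "(s\<^sup>2)\<^sup>2 = s ^ 4"
    by simp
  have bounds: "s\<^sup>2 \<noteq> 0" "0 < u" "u < w" "w < 1" "0 < s" "w < s"
    using u u2 w w_le s2 s by simp_all
  have "determines_hyperbola (five_points (s\<^sup>2) u s w)"
    using less lower upper E1 E2 s
    by (intro five_points_determine_hyperbola bounds; unfold a4)
       (simp_all flip: r_def f1_def f2_def g_def)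
  moreover have "card (five_points (s\<^sup>2) u s w) = 5"
    using bounds by (intro card_five_points) auto
  moreover have "five_points (s\<^sup>2) u s w \<subseteq> S"
  proof -
    have "(1 - u) powr p = 1 - s ^ 4 / 4" "(1 - w) powr p = 1 - s\<^sup>2 / 2"
      unfolding u_def w_def using s s2 s4 pos by (simp_all add: cap_powr p_def)
    then show ?thesis
      using bounds s sp s2p unfolding S_def five_points_def p_def[symmetric]
      by auto
  qed
  ultimately show ?thesis
    using that by blast
qed

theorem corollary3:
  fixes S :: "(real \<times> real) set"
  defines "S \<equiv> {(x, y). \<bar>x\<bar> powr 2.001 + \<bar>y\<bar> powr 2.001 = 1}"
  shows "(\<exists>P. P \<subseteq> S \<and> card P = 5 \<and> determines_hyperbola P) \<and>
         \<not> (\<forall>P. P \<subseteq> S \<and> card P = 5 \<longrightarrow> determines_ellipse P)"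
  using hyperbola_on_superellipse determines_hyperbola_not_ellipse unfolding S_def by metis

end
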